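(* Let $B$ be a reflexive, strictly convex, Fréchet smooth real Banach space with property (KK). Let $M$ be a non-empty, closed, convex subset of $B$ and let $N$ be a non-empty, compact subset of $B$. Then $(M,N)$ satisfies the property ($\phi$-UC).
   Context: $B$ is Fréchet smooth if its norm is Fréchet differentiable at every nonzero point (in particular $B$ is smooth). $B$ has property (KK) if norm and weak convergence (of sequences) coincide on the unit sphere $S_B=\{u\in B:\|u\|=1\}$. $J:B\to B^*$ is the (single-valued) normalized duality mapping: $\langle u,Ju\rangle=\|u\|^2=\|Ju\|^2$. Define $\phi(u,v)=\|u\|^2-2\langle u,Jv\rangle+\|v\|^2$ and $\mathrm{dist}_\phi(M,N)=\inf\{\phi(u,v):u\in M,v\in N\}$. A pair $(M,N)$ of non-empty subsets of a smooth Banach space satisfies the property ($\phi$-UC) if, whenever $(u_n),(v_n)$ in $M$ and $(t_n)$ in $N$ are sequences with $\phi(u_n,t_n)\to\mathrm{dist}_\phi(M,N)$ and $\phi(v_n,t_n)\to\mathrm{dist}_\phi(M,N)$ as $n\to\infty$, one has $\phi(u_n,v_n)\to0$. *)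

theory Defs
  imports "HOL-Analysis.Analysis"
begin

text \<open>
  The dual of a real normed space \<open>'a\<close> is \<open>'a \<Rightarrow>\<^sub>L real\<close> with the operator norm; the duality
  pairing of \<open>u\<close> and \<open>f\<close> is \<open>blinfun_apply f u\<close>. Properties of the space itself are
  predicates on \<open>TYPE('a)\<close>.
\<close>

definition bidual_embedding ::
    "'a::real_normed_vector \<Rightarrow> ('a \<Rightarrow>\<^sub>L real) \<Rightarrow>\<^sub>L real" where
  "bidual_embedding x = Blinfun (\<lambda>f. blinfun_apply f x)"

lemma bidual_embedding_apply [simp]:
  "blinfun_apply (bidual_embedding x) f = blinfun_apply f x"
  unfolding bidual_embedding_def
  by (simp add: bounded_linear_Blinfun_apply blinfun.bounded_linear_left)

definition reflexive_space :: "'a::real_normed_vector itself \<Rightarrow> bool" where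
  "reflexive_space _ \<longleftrightarrow>
     surj (bidual_embedding :: 'a \<Rightarrow> ('a \<Rightarrow>\<^sub>L real) \<Rightarrow>\<^sub>L real)"

definition strictly_convex_space :: "'a::real_normed_vector itself \<Rightarrow> bool" where
  "strictly_convex_space _ \<longleftrightarrow>
     (\<forall>x y :: 'a. norm x = 1 \<longrightarrow> norm y = 1 \<longrightarrow> x \<noteq> y \<longrightarrow> norm ((1/2) *\<^sub>R (x + y)) < 1)"

definition frechet_smooth_space :: "'a::real_normed_vector itself \<Rightarrow> bool" where
  "frechet_smooth_space _ \<longleftrightarrow>
     (\<forall>x :: 'a. x \<noteq> 0 \<longrightarrow> (norm :: 'a \<Rightarrow> real) differentiable (at x))"

definition weakly_converges :: "(nat \<Rightarrow> 'a::real_normed_vector) \<Rightarrow> 'a \<Rightarrow> bool" where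
  "weakly_converges X x \<longleftrightarrow>
     (\<forall>f :: 'a \<Rightarrow>\<^sub>L real. (\<lambda>n. blinfun_apply f (X n)) \<longlonglongrightarrow> blinfun_apply f x)"

definition KK_space :: "'a::real_normed_vector itself \<Rightarrow> bool" where
  "KK_space _ \<longleftrightarrow>
     (\<forall>(X :: nat \<Rightarrow> 'a) x. (\<forall>n. X n \<in> sphere 0 1) \<longrightarrow> x \<in> sphere 0 1 \<longrightarrow>
        (weakly_converges X x \<longleftrightarrow> X \<longlonglongrightarrow> x))"

text \<open>
  A functional as described below always exists by the Hahn-Banach theorem, and it is unique
  when the space is smooth; the definite description is meaningful only in that case.
\<close>

definition duality_map :: "'a::real_normed_vector \<Rightarrow> 'a \<Rightarrow>\<^sub>L real" where
  "duality_map u =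
     (THE j. blinfun_apply j u = (norm u)\<^sup>2 \<and> (norm u)\<^sup>2 = (norm j)\<^sup>2)"

definition phi :: "'a::real_normed_vector \<Rightarrow> 'a \<Rightarrow> real" where
  "phi u v = (norm u)\<^sup>2 - 2 * blinfun_apply (duality_map v) u + (norm v)\<^sup>2"

text \<open>
  In a smooth space \<open>phi u v \<ge> (norm u - norm v)\<^sup>2 \<ge> 0\<close>, so for non-empty \<open>M\<close>
  and \<open>N\<close> the real infimum below is the genuine one.
\<close>

definition dist_phi :: "'a::real_normed_vector set \<Rightarrow> 'a set \<Rightarrow> real" where
  "dist_phi M N = Inf {phi u v | u v. u \<in> M \<and> v \<in> N}"

definition phi_UC :: "'a::real_normed_vector set \<Rightarrow> 'a set \<Rightarrow> bool" where
  "phi_UC M N \<longleftrightarrow>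
     (\<forall>u v t :: nat \<Rightarrow> 'a.
        (\<forall>n. u n \<in> M) \<longrightarrow> (\<forall>n. v n \<in> M) \<longrightarrow> (\<forall>n. t n \<in> N) \<longrightarrow>
        (\<lambda>n. phi (u n) (t n)) \<longlonglongrightarrow> dist_phi M N \<longrightarrow>
        (\<lambda>n. phi (v n) (t n)) \<longlonglongrightarrow> dist_phi M N \<longrightarrow>
        (\<lambda>n. phi (u n) (v n)) \<longlonglongrightarrow> 0)"

end

theory Submission
  imports Defs
begin

text \<open>
  Let \<open>phi (u n) (t n)\<close> tend to the distance \<open>d\<close>. Along a subsequence \<open>t n\<close> converges to some
  \<open>l \<in> N\<close> by compactness. Frechet smoothness makes the duality mapping norm continuous, so
  \<open>phi (u n) l\<close> tends to \<open>d\<close> as well, i.e. \<open>u n\<close> minimizes the convex function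
  \<open>\<lambda>m. phi m l\<close> on \<open>M\<close>. By reflexivity the minimum is attained at weak cluster points of \<open>u\<close>,
  by strict convexity there is only one minimizer \<open>x\<close>, so \<open>u n\<close> converges to \<open>x\<close> weakly and in
  norm, and strongly by (KK). The same holds for \<open>v n\<close>, and then
  \<open>phi (u n) (v n)\<close> tends to \<open>phi x x = 0\<close>.
\<close>

subsection \<open>Sublinear functionals and the Hahn--Banach theorem\<close>

definition sublinear :: "('a::real_vector \<Rightarrow> real) \<Rightarrow> bool" where
  "sublinear p \<longleftrightarrow> (\<forall>x y. p (x + y) \<le> p x + p y) \<and> (\<forall>a\<ge>0. \<forall>x. p (a *\<^sub>R x) = a * p x)"

lemma sublinear_add: "sublinear p \<Longrightarrow> p (x + y) \<le> p x + p y"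
  and sublinear_scale: "sublinear p \<Longrightarrow> a \<ge> 0 \<Longrightarrow> p (a *\<^sub>R x) = a * p x"
  by (auto simp: sublinear_def)

lemma sublinear_zero: "sublinear p \<Longrightarrow> p 0 = 0"
  using sublinear_scale[of p 0 0] by simp

lemma sublinear_minus: "sublinear p \<Longrightarrow> - p (- x) \<le> p x"
  using sublinear_add[of p x "- x"] sublinear_zero[of p] by simp

text \<open>Combining the scaling inequality for \<open>a\<close> with the one for
  \<open>inverse a\<close> yields equality, so a functional defined as an infimum needs only upper
  bounds here.\<close>

lemma sublinearI:
  assumes add: "\<And>x y. p (x + y) \<le> p x + p y"
    and scale: "\<And>a x. a > 0 \<Longrightarrow> p (a *\<^sub>R x) \<le> a * p x"
    and zero: "p 0 = 0"
  shows "sublinear p"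
  unfolding sublinear_def
proof (intro conjI allI impI)
  fix a :: real and x assume "a \<ge> 0"
  show "p (a *\<^sub>R x) = a * p x"
  proof (cases "a = 0")
    case False
    with \<open>a \<ge> 0\<close> have a: "a > 0" by simp
    have "p x \<le> inverse a * p (a *\<^sub>R x)"
      using scale[of "inverse a" "a *\<^sub>R x"] a by simp
    with a have "a * p x \<le> p (a *\<^sub>R x)" by (simp add: field_simps)
    with scale[OF a, of x] show ?thesis by simp
  qed (simp add: zero)
qed (rule add)

lemma sublinear_norm: "sublinear norm"
  by (rule sublinearI) (auto intro: norm_triangle_ineq)

text \<open>
  The witness is \<open>p y = Inf {q (y + t *\<^sub>R c) - t * d | t \<ge> 0, c \<in> C}\<close>. With \<open>C = {y}\<close> and
  \<open>d = q y\<close> this shows that a minimal sublinear functional is odd, hence linear.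
\<close>

lemma sublinear_lower:
  fixes q :: "'a::real_vector \<Rightarrow> real"
  assumes q: "sublinear q" and C: "convex C" "C \<noteq> {}" and d: "\<And>c. c \<in> C \<Longrightarrow> d \<le> q c"
  obtains p where "sublinear p" "p \<le> q" "\<And>c. c \<in> C \<Longrightarrow> p (- c) \<le> - d"
proof
  define S where "S y = {q (y + t *\<^sub>R c) - t * d | t c. t \<ge> 0 \<and> c \<in> C}" for y
  define p where "p y = Inf (S y)" for y
  have ne: "S y \<noteq> {}" for y using C(2) unfolding S_def by (auto intro: exI[of _ 0])
  \<comment> \<open>The bound does not involve \<open>t\<close> or \<open>c\<close>, so the infimum
    is finite. The hypothesis that \<open>q\<close> is at least \<open>d\<close> on \<open>C\<close>
    enters here.\<close>
  have lb: "- q (- y) \<le> s" if "s \<in> S y" for s y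
  proof -
    from that obtain t c where t: "t \<ge> 0" "c \<in> C" "s = q (y + t *\<^sub>R c) - t * d"
      unfolding S_def by auto
    have "t * d \<le> t * q c" using t d by (simp add: mult_left_mono)
    also have "\<dots> = q (t *\<^sub>R c)" using t q by (simp add: sublinear_scale)
    also have "\<dots> \<le> q (y + t *\<^sub>R c) + q (- y)"
      using sublinear_add[OF q, of "y + t *\<^sub>R c" "- y"] by simp
    finally show ?thesis using t by simp
  qed
  have bdd: "bdd_below (S y)" for y using lb by (meson bdd_belowI)
  have le: "p y \<le> q (y + t *\<^sub>R c) - t * d" if "t \<ge> 0" "c \<in> C" for y t c
    unfolding p_def using that by (intro cInf_lower bdd) (auto simp: S_def)
  have ge: "k \<le> p y" if "\<And>t c. t \<ge> 0 \<Longrightarrow> c \<in> C \<Longrightarrow> k \<le> q (y + t *\<^sub>R c) - t * d" for k y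
    unfolding p_def using that by (intro cInf_greatest ne) (auto simp: S_def)
  obtain c0 where c0: "c0 \<in> C" using C by auto
  show pq: "p \<le> q" using le[of 0 c0] c0 by (auto simp: le_fun_def)
  show "p (- c) \<le> - d" if "c \<in> C" for c
    using le[of 1 c "- c"] that sublinear_zero[OF q] by simp
  show "sublinear p"
  proof (rule sublinearI)
    fix x y
    have "p (x + y) \<le> q (x + t *\<^sub>R b) - t * d + (q (y + s *\<^sub>R c) - s * d)"
      if "t \<ge> 0" "b \<in> C" "s \<ge> 0" "c \<in> C" for t b s c
    proof -
      \<comment> \<open>By convexity the weights \<open>t\<close> on \<open>b\<close> and
        \<open>s\<close> on \<open>c\<close> merge into the weight \<open>t + s\<close> on a single
        point of \<open>C\<close>, so competitors for \<open>x\<close> and \<open>y\<close> combine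
        into one for \<open>x + y\<close>. If both weights vanish, any point of \<open>C\<close>
        serves.\<close>
      obtain e where e: "e \<in> C" "(t + s) *\<^sub>R e = t *\<^sub>R b + s *\<^sub>R c"
      proof (cases "t + s = 0")
        case True
        then have "t = 0" "s = 0" using \<open>t \<ge> 0\<close> \<open>s \<ge> 0\<close> by auto
        then show ?thesis using that[of b] \<open>b \<in> C\<close> by simp
      next
        case False
        then have ts: "t + s > 0" using \<open>t \<ge> 0\<close> \<open>s \<ge> 0\<close> by simp
        have "(t / (t + s)) *\<^sub>R b + (s / (t + s)) *\<^sub>R c \<in> C"
          using C(1) \<open>t \<ge> 0\<close> \<open>s \<ge> 0\<close> \<open>b \<in> C\<close> \<open>c \<in> C\<close> ts
          by (intro convexD) (auto simp: add_divide_distrib[symmetric])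
        moreover have "(t + s) *\<^sub>R ((t / (t + s)) *\<^sub>R b + (s / (t + s)) *\<^sub>R c) = t *\<^sub>R b + s *\<^sub>R c"
          using ts by (simp add: scaleR_add_right)
        ultimately show ?thesis using that by blast
      qed
      have "p (x + y) \<le> q ((x + y) + (t + s) *\<^sub>R e) - (t + s) * d"
        using le[of "t + s" e] that e(1) by simp
      also have "(x + y) + (t + s) *\<^sub>R e = (x + t *\<^sub>R b) + (y + s *\<^sub>R c)"
        using e by simp
      finally show ?thesis
        using sublinear_add[OF q, of "x + t *\<^sub>R b" "y + s *\<^sub>R c"] by (simp add: algebra_simps)
    qed
    then have "p (x + y) - (q (y + s *\<^sub>R c) - s * d) \<le> p x" if "s \<ge> 0" "c \<in> C" for s c
      using that by (intro ge) (simp only: diff_le_eq)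
    then have "p (x + y) - p x \<le> p y"
      by (intro ge) (simp only: diff_le_eq add.commute)
    then show "p (x + y) \<le> p x + p y" by simp
  next
    fix a :: real and x assume a: "a > 0"
    have "p (a *\<^sub>R x) / a \<le> p x"
    proof (rule ge)
      fix t c assume tc: "(t::real) \<ge> 0" "c \<in> C"
      have "p (a *\<^sub>R x) \<le> q (a *\<^sub>R (x + t *\<^sub>R c)) - (a * t) * d"
        using le[of "a * t" c "a *\<^sub>R x"] tc a by (simp add: scaleR_add_right)
      also have "\<dots> = a * (q (x + t *\<^sub>R c) - t * d)"
        using a sublinear_scale[OF q, of a "x + t *\<^sub>R c"] by (simp add: right_diff_distrib)
      finally show "p (a *\<^sub>R x) / a \<le> q (x + t *\<^sub>R c) - t * d"
        using a by (simp add: field_simps)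
    qed
    then show "p (a *\<^sub>R x) \<le> a * p x" using a by (simp add: field_simps)
  next
    have "p 0 \<le> 0" using pq sublinear_zero[OF q] by (metis le_funD)
    moreover have "0 \<le> p 0" unfolding p_def
      using lb[of _ 0] sublinear_zero[OF q] by (intro cInf_greatest ne) auto
    ultimately show "p 0 = 0" by simp
  qed
qed

text \<open>Zorn's lemma for the reversed pointwise order. A nonempty chain is bounded by its
  pointwise infimum, finite because every member \<open>p\<close> below \<open>q\<close> satisfies
  \<open>- q (- x) \<le> p x\<close>.\<close>

lemma sublinear_minimal:
  fixes q :: "'a::real_vector \<Rightarrow> real"
  assumes q: "sublinear q"
  obtains m where "sublinear m" "m \<le> q" "\<And>p. sublinear p \<Longrightarrow> p \<le> m \<Longrightarrow> p = m"
proof -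
  define A where "A = {p. sublinear p \<and> p \<le> q}"
  have "\<exists>m\<in>A. \<forall>a\<in>A. a \<le> m \<longrightarrow> a = m"
  proof (rule predicate_Zorn)
    show "partial_order_on A (relation_of (\<lambda>x y. y \<le> x) A)"
      by (auto simp: partial_order_on_def preorder_on_def relation_of_def refl_on_def
          intro!: transI antisymI)
  next
    fix C assume C: "C \<in> Chains (relation_of (\<lambda>x y. y \<le> x) A)"
    then have CA: "p \<in> A" if "p \<in> C" for p
      using that by (auto simp: Chains_def relation_of_def)
    have tot: "p \<le> r \<or> r \<le> p" if "p \<in> C" "r \<in> C" for p r
      using that C by (auto simp: Chains_def relation_of_def)
    show "\<exists>u\<in>A. \<forall>a\<in>C. u \<le> a"
    proof (cases "C = {}")
      case True
      then show ?thesis using q by (auto simp: A_def)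
    next
      case False
      define i where "i x = (INF p\<in>C. p x)" for x
      have "- q (- x) \<le> p x" if "p \<in> C" for p x
      proof -
        from CA[OF that] have "sublinear p" "p (- x) \<le> q (- x)" by (auto simp: A_def le_fun_def)
        then show ?thesis using sublinear_minus[of p x] by simp
      qed
      then have bdd: "bdd_below ((\<lambda>p. p x) ` C)" for x by (meson bdd_belowI2)
      have le: "i x \<le> p x" if "p \<in> C" for p x
        unfolding i_def using that by (intro cINF_lower bdd)
      have ge: "k \<le> i x" if "\<And>p. p \<in> C \<Longrightarrow> k \<le> p x" for k x
        unfolding i_def using that False by (intro cINF_greatest)
      have sub: "sublinear p" if "p \<in> C" for p using CA[OF that] by (simp add: A_def)
      have "sublinear i"
      proof (rule sublinearI)
        fix x y
        have "i (x + y) \<le> p x + r y" if pr: "p \<in> C" "r \<in> C" for p r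
        proof -
          \<comment> \<open>Members of a chain are comparable, so the smaller of \<open>p\<close>
            and \<open>r\<close> lies below both, and its subadditivity passes to the
            infimum.\<close>
          obtain e where e: "e \<in> C" "e \<le> p" "e \<le> r" using tot[OF pr] pr by auto
          have "i (x + y) \<le> e x + e y" using le[OF e(1)] sublinear_add[OF sub[OF e(1)]]
            by (meson order_trans)
          also have "\<dots> \<le> p x + r y" using e by (intro add_mono) (auto simp: le_fun_def)
          finally show ?thesis .
        qed
        then have "i (x + y) - r y \<le> i x" if "r \<in> C" for r
          using that by (intro ge) (auto simp: algebra_simps)
        then have "i (x + y) - i x \<le> i y" by (intro ge) (auto simp: algebra_simps)
        then show "i (x + y) \<le> i x + i y" by simp
      next
        fix a :: real and x assume a: "a > 0"
        have "i (a *\<^sub>R x) / a \<le> i x"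
        proof (rule ge)
          fix p assume p: "p \<in> C"
          show "i (a *\<^sub>R x) / a \<le> p x"
            using le[OF p, of "a *\<^sub>R x"] sublinear_scale[OF sub[OF p], of a x] a
            by (simp add: field_simps)
        qed
        then show "i (a *\<^sub>R x) \<le> a * i x" using a by (simp add: field_simps)
      next
        have "(\<lambda>p. p 0) ` C = {0}" using False sublinear_zero[OF sub] by force
        then show "i 0 = 0" unfolding i_def by simp
      qed
      moreover have "i \<le> q"
      proof -
        obtain p where p: "p \<in> C" using False by auto
        have "i \<le> p" using le[OF p] by (simp add: le_fun_def)
        also have "p \<le> q" using CA[OF p] by (simp add: A_def)
        finally show ?thesis .
      qed
      ultimately show ?thesis using le by (auto simp: A_def le_fun_def)
    qed
  qed
  then show ?thesis using that unfolding A_def by (blast intro: order_trans)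
qed

lemma sublinear_minimal_linear:
  fixes m :: "'a::real_vector \<Rightarrow> real"
  assumes m: "sublinear m" and min: "\<And>p. sublinear p \<Longrightarrow> p \<le> m \<Longrightarrow> p = m"
  shows "linear m"
proof -
  have neg: "m (- y) = - m y" for y
  proof -
    obtain p where p: "sublinear p" "p \<le> m" "p (- y) \<le> - m y"
      using sublinear_lower[OF m, of "{y}" "m y"] by auto
    with min have "m (- y) \<le> - m y" by metis
    then show ?thesis using sublinear_minus[OF m, of y] by simp
  qed
  show ?thesis
  proof (rule linearI)
    fix x y
    \<comment> \<open>Oddness turns this instance of subadditivity into superadditivity.\<close>
    have "m x \<le> m (x + y) + m (- y)" using sublinear_add[OF m, of "x + y" "- y"] by simp
    then show "m (x + y) = m x + m y" using neg[of y] sublinear_add[OF m, of x y] by simp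
  next
    fix a x
    show "m (a *\<^sub>R x) = a *\<^sub>R m x"
    proof (cases "a \<ge> 0")
      case False
      then have "m ((- a) *\<^sub>R x) = (- a) * m x" by (intro sublinear_scale[OF m]) simp
      then show ?thesis using neg[of "a *\<^sub>R x"] by simp
    qed (simp add: sublinear_scale[OF m])
  qed
qed

text \<open>Push \<open>q\<close> down to a \<open>p\<close> with \<open>p (- c) \<le> - d\<close>
  on \<open>C\<close>, then take a minimal, hence linear, functional below \<open>p\<close>;
  linearity turns the bound at \<open>- c\<close> into \<open>d \<le> f c\<close>. The form with a
  convex set covers norming functionals (a singleton), separation (a translate) and plain domination
  (\<open>{0}\<close> with \<open>d = 0\<close>).\<close>

theorem Hahn_Banach_convex:
  fixes q :: "'a::real_vector \<Rightarrow> real"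
  assumes q: "sublinear q" and C: "convex C" "C \<noteq> {}" and d: "\<And>c. c \<in> C \<Longrightarrow> d \<le> q c"
  obtains f where "linear f" "f \<le> q" "\<And>c. c \<in> C \<Longrightarrow> d \<le> f c"
proof -
  obtain p where p: "sublinear p" "p \<le> q" and pC: "\<And>c. c \<in> C \<Longrightarrow> p (- c) \<le> - d"
    using sublinear_lower[OF q C d] by metis
  obtain f where f: "sublinear f" "f \<le> p" "\<And>g. sublinear g \<Longrightarrow> g \<le> f \<Longrightarrow> g = f"
    using sublinear_minimal[OF p(1)] by metis
  have lin: "linear f" using sublinear_minimal_linear f by metis
  show ?thesis
  proof (rule that)
    show "f \<le> q" using f p by (metis order_trans)
    show "d \<le> f c" if "c \<in> C" for c
      using pC[OF that] le_funD[OF f(2), of "- c"] linear_neg[OF lin, of c] by simp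
  qed (rule lin)
qed

lemma linear_le_norm_blinfun:
  fixes f :: "'a::real_normed_vector \<Rightarrow> real"
  assumes lin: "linear f" and le: "\<And>x. f x \<le> K * norm x"
  obtains F where "blinfun_apply F = f"
proof -
  have "bounded_linear f"
  proof (intro bounded_linear_intro[of f K])
    fix x y show "f (x + y) = f x + f y" by (rule linear_add[OF lin])
  next
    fix r x show "f (r *\<^sub>R x) = r *\<^sub>R f x" by (rule linear_scale[OF lin])
  next
    fix x show "norm (f x) \<le> norm x * K"
      using le[of x] le[of "- x"] linear_neg[OF lin, of x] by (simp add: mult.commute)
  qed
  then show ?thesis using that[of "Blinfun f"] bounded_linear_Blinfun_apply by blast
qed

corollary Hahn_Banach_norm:
  fixes C :: "'a::real_normed_vector set"
  assumes "convex C" "C \<noteq> {}" "\<And>c. c \<in> C \<Longrightarrow> d \<le> norm c"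
  obtains f :: "'a \<Rightarrow>\<^sub>L real" where "norm f \<le> 1" "\<And>c. c \<in> C \<Longrightarrow> d \<le> blinfun_apply f c"
proof -
  obtain g where g: "linear g" "g \<le> norm" "\<And>c. c \<in> C \<Longrightarrow> d \<le> g c"
    using Hahn_Banach_convex[OF sublinear_norm assms] by metis
  have le: "g x \<le> norm x" for x using g(2) by (simp add: le_fun_def)
  obtain f where f: "blinfun_apply f = g"
    using linear_le_norm_blinfun[OF g(1), of 1] le by auto
  show ?thesis
  proof (rule that[of f])
    show "norm f \<le> 1"
    proof (rule norm_blinfun_bound)
      fix x show "norm (blinfun_apply f x) \<le> 1 * norm x"
        using le[of x] le[of "- x"] linear_neg[OF g(1), of x] by (simp add: f)
    qed simp
  qed (simp add: f g)
qed

subsection \<open>Weak limits in reflexive spaces\<close>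

text \<open>The convex set \<open>x - M\<close> has all its norms at least
  \<open>infdist x M\<close>, which is positive as \<open>M\<close> is closed; a functional of norm
  at most 1 that is at least this large on \<open>x - M\<close> separates with that gap.\<close>

lemma separate_closed_convex:
  fixes M :: "'a::real_normed_vector set"
  assumes M: "closed M" "convex M" "M \<noteq> {}" and x: "x \<notin> M"
  obtains f :: "'a \<Rightarrow>\<^sub>L real" and d where "d > 0" "\<And>m. m \<in> M \<Longrightarrow> blinfun_apply f m + d \<le> blinfun_apply f x"
proof -
  define C where "C = (\<lambda>m. x - m) ` M"
  have "infdist x M > 0"
    using M x in_closed_iff_infdist_zero[of M x] infdist_nonneg[of x M] by linarith
  moreover have "infdist x M \<le> norm c" if "c \<in> C" for c
    using that infdist_le[of _ M x] by (auto simp: C_def dist_norm)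
  moreover have "convex C"
  proof -
    have "C = (+) x ` ((\<lambda>m. - m) ` M)" by (auto simp: C_def image_image)
    then show ?thesis using M(2) by (simp add: convex_translation convex_negations)
  qed
  moreover have "C \<noteq> {}" using M(3) by (simp add: C_def)
  ultimately obtain f :: "'a \<Rightarrow>\<^sub>L real"
    where "\<And>c. c \<in> C \<Longrightarrow> infdist x M \<le> blinfun_apply f c"
    using Hahn_Banach_norm[of C "infdist x M"] by metis
  then have "blinfun_apply f m + infdist x M \<le> blinfun_apply f x" if "m \<in> M" for m
    using that by (fastforce simp: C_def blinfun.diff_right)
  with \<open>infdist x M > 0\<close> show ?thesis by (rule that)
qed

text \<open>
  A linear functional on the dual below \<open>p f = limsup f (u n)\<close> is evaluation at a point by
  reflexivity; this replaces the extraction of a weakly convergent subsequence.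
\<close>

lemma reflexive_cluster_point:
  fixes u :: "nat \<Rightarrow> 'a::real_normed_vector"
  assumes refl: "reflexive_space TYPE('a)" and bdd: "bounded (range u)"
  obtains x where "\<And>(f :: 'a \<Rightarrow>\<^sub>L real) c. eventually (\<lambda>n. blinfun_apply f (u n) \<le> c) sequentially \<Longrightarrow> blinfun_apply f x \<le> c"
proof -
  obtain K where K: "\<And>n. norm (u n) \<le> K" using bdd by (auto simp: bounded_iff)
  define S where "S f = {c. eventually (\<lambda>n. blinfun_apply f (u n) \<le> c) sequentially}"
    for f :: "'a \<Rightarrow>\<^sub>L real"
  define p where "p f = Inf (S f)" for f
  have ap: "\<bar>blinfun_apply f (u n)\<bar> \<le> K * norm f" for f n
    using norm_blinfun[of f "u n"] mult_left_mono[OF K[of n], of "norm f"] by (simp add: mult.commute)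
  have inS: "K * norm f \<in> S f" for f
    using ap[of f] unfolding S_def by (auto intro!: always_eventually dest: abs_le_D1)
  have lb: "- (K * norm f) \<le> c" if "c \<in> S f" for c f
  proof -
    from that obtain n where "blinfun_apply f (u n) \<le> c"
      unfolding S_def by (auto dest: eventually_happens)
    with ap[of f n] show ?thesis by linarith
  qed
  have le: "p f \<le> c" if "c \<in> S f" for f c
    unfolding p_def using that lb by (intro cInf_lower) (auto intro!: bdd_belowI)
  have ge: "k \<le> p f" if "\<And>c. c \<in> S f \<Longrightarrow> k \<le> c" for k f
    unfolding p_def using that inS by (intro cInf_greatest) auto
  have "sublinear p"
  proof (rule sublinearI)
    fix f g
    have "p (f + g) \<le> c + d" if "c \<in> S f" "d \<in> S g" for c d
    proof (rule le)
      show "c + d \<in> S (f + g)"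
        using that unfolding S_def mem_Collect_eq
        by eventually_elim (simp add: blinfun.add_left)
    qed
    then have "p (f + g) - d \<le> p f" if "d \<in> S g" for d
      using that by (intro ge) (auto simp: algebra_simps)
    then have "p (f + g) - p f \<le> p g" by (intro ge) (auto simp: algebra_simps)
    then show "p (f + g) \<le> p f + p g" by simp
  next
    fix a :: real and f assume a: "a > 0"
    have "p (a *\<^sub>R f) / a \<le> p f"
    proof (rule ge)
      fix c assume "c \<in> S f"
      then have "a * c \<in> S (a *\<^sub>R f)" using a by (simp add: S_def blinfun.scaleR_left)
      from le[OF this] show "p (a *\<^sub>R f) / a \<le> c" using a by (simp add: field_simps)
    qed
    then show "p (a *\<^sub>R f) \<le> a * p f" using a by (simp add: field_simps)
  next
    show "p 0 = 0" using le[OF inS, of 0] ge[of 0 0] lb[of _ 0] by fastforce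
  qed
  \<comment> \<open>With \<open>C = {0}\<close> and bound 0 the extension theorem just provides a
    linear functional dominated by \<open>p\<close>.\<close>
  then obtain g where g: "linear g" "g \<le> p"
    using Hahn_Banach_convex[of p "{0}" 0] sublinear_zero[of p] by auto
  have gp: "g f \<le> p f" for f using g(2) by (simp add: le_fun_def)
  have "g f \<le> K * norm f" for f using gp[of f] le[OF inS, of f] by linarith
  then obtain G where G: "blinfun_apply G = g" using linear_le_norm_blinfun[OF g(1)] by blast
  obtain x where x: "G = bidual_embedding x"
    using refl unfolding reflexive_space_def by (metis surjD)
  show ?thesis
  proof (rule that[of x])
    fix f :: "'a \<Rightarrow>\<^sub>L real" and c assume "eventually (\<lambda>n. blinfun_apply f (u n) \<le> c) sequentially"
    then have "p f \<le> c" by (intro le) (simp add: S_def)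
    then show "blinfun_apply f x \<le> c"
      using gp[of f] bidual_embedding_apply[of x f] unfolding x[symmetric] G by simp
  qed
qed

subsection \<open>Minimizing sequences\<close>

text \<open>Otherwise some neighbourhood of \<open>l\<close> is missed along a whole subsequence.
  This lets compactness arguments, which only yield subsequences, prove convergence of the full
  sequence.\<close>

lemma LIMSEQ_of_subsequences:
  fixes X :: "nat \<Rightarrow> 'a::topological_space"
  assumes "\<And>r :: nat \<Rightarrow> nat. strict_mono r \<Longrightarrow> \<exists>s :: nat \<Rightarrow> nat. strict_mono s \<and> (\<lambda>n. X (r (s n))) \<longlonglongrightarrow> l"
  shows "X \<longlonglongrightarrow> l"
proof (rule topological_tendstoI, rule ccontr)
  fix S assume S: "open S" "l \<in> S" and "\<not> eventually (\<lambda>n. X n \<in> S) sequentially"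
  then obtain r :: "nat \<Rightarrow> nat" where r: "strict_mono r" "\<And>n. X (r n) \<notin> S"
    using not_eventually_sequentiallyD by blast
  then obtain s where "(\<lambda>n. X (r (s n))) \<longlonglongrightarrow> l" using assms by blast
  from topological_tendstoD[OF this S] r(2) show False by simp
qed

text \<open>Bolzano-Weierstrass for bounded triples of reals replaces three successive
  extractions.\<close>

lemma convergent_subsequence3:
  fixes a b c :: "nat \<Rightarrow> real"
  assumes "Bseq a" "Bseq b" "Bseq c"
  obtains r :: "nat \<Rightarrow> nat" and x y z where "strict_mono r"
    "(\<lambda>n. a (r n)) \<longlonglongrightarrow> x" "(\<lambda>n. b (r n)) \<longlonglongrightarrow> y" "(\<lambda>n. c (r n)) \<longlonglongrightarrow> z"
proof -
  have "bounded (range (\<lambda>n. (a n, b n, c n)))"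
  proof (rule bounded_subset)
    show "bounded (range a \<times> range b \<times> range c)"
      using assms by (intro bounded_Times) (auto simp: Bseq_eq_bounded)
  qed auto
  from bounded_imp_convergent_subsequence[OF this]
  obtain l r where "strict_mono r" and l: "((\<lambda>n. (a n, b n, c n)) \<circ> r) \<longlonglongrightarrow> l" by blast
  from tendsto_fst[OF l] tendsto_fst[OF tendsto_snd[OF l]] tendsto_snd[OF tendsto_snd[OF l]]
  show ?thesis by (intro that[OF \<open>strict_mono r\<close>]) (simp_all add: o_def)
qed

text \<open>Only finitely many scalar sequences are made convergent at once, so the weak cluster
  point \<open>x\<close> may depend on the test functional \<open>h\<close>; uniqueness of the
  minimizer removes this dependence later.\<close>

lemma minimizing_subsequence:
  fixes u :: "nat \<Rightarrow> 'a::real_normed_vector" and j h :: "'a \<Rightarrow>\<^sub>L real"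
  assumes refl: "reflexive_space TYPE('a)" and M: "closed M" "convex M"
    and uM: "\<And>n. u n \<in> M" and bdd: "bounded (range u)"
    and lim: "(\<lambda>n. (norm (u n))\<^sup>2 - 2 * blinfun_apply j (u n)) \<longlonglongrightarrow> d"
    and d: "\<And>m. m \<in> M \<Longrightarrow> d \<le> (norm m)\<^sup>2 - 2 * blinfun_apply j m"
  obtains s :: "nat \<Rightarrow> nat" and x where "strict_mono s" "x \<in> M" "(norm x)\<^sup>2 - 2 * blinfun_apply j x = d"
    "(\<lambda>n. blinfun_apply h (u (s n))) \<longlonglongrightarrow> blinfun_apply h x"
    "(\<lambda>n. norm (u (s n))) \<longlonglongrightarrow> norm x"
proof -
  have B: "Bseq (\<lambda>n. blinfun_apply f (u n))" for f :: "'a \<Rightarrow>\<^sub>L real"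
    using bounded_linear_image[OF bdd blinfun.bounded_linear_right[of f]]
    by (simp add: Bseq_eq_bounded image_image)
  have Bn: "Bseq (\<lambda>n. norm (u n))"
    using bdd by (auto simp: Bseq_eq_bounded bounded_iff)
  obtain s :: "nat \<Rightarrow> nat" and r a b where s: "strict_mono s"
    and r: "(\<lambda>n. norm (u (s n))) \<longlonglongrightarrow> r"
    and a: "(\<lambda>n. blinfun_apply j (u (s n))) \<longlonglongrightarrow> a"
    and b: "(\<lambda>n. blinfun_apply h (u (s n))) \<longlonglongrightarrow> b"
    using convergent_subsequence3[OF Bn B[of j] B[of h]] by blast
  have "bounded (range (u \<circ> s))" using bdd by (rule bounded_subset) auto
  from reflexive_cluster_point[OF refl this]
  obtain x where x: "\<And>(f :: 'a \<Rightarrow>\<^sub>L real) c. eventually (\<lambda>n. blinfun_apply f (u (s n)) \<le> c) sequentially \<Longrightarrow> blinfun_apply f x \<le> c"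
    by (auto simp: o_def)
  have xle: "blinfun_apply f x \<le> c"
    if "X \<longlonglongrightarrow> c" "\<And>n. blinfun_apply f (u (s n)) \<le> X n" for f :: "'a \<Rightarrow>\<^sub>L real" and c X
  proof (rule field_le_epsilon)
    fix e :: real assume "e > 0"
    then have "eventually (\<lambda>n. X n < c + e) sequentially"
      using that(1) by (intro order_tendstoD) auto
    then show "blinfun_apply f x \<le> c + e"
      by (intro x) (auto elim!: eventually_mono intro: order_trans[OF that(2)])
  qed
  \<comment> \<open>Where the scalar sequence converges, the one-sided property of the cluster point
    applies to both \<open>f\<close> and \<open>- f\<close>.\<close>
  have xeq: "blinfun_apply f x = c" if f: "(\<lambda>n. blinfun_apply f (u (s n))) \<longlonglongrightarrow> c" for f :: "'a \<Rightarrow>\<^sub>L real" and c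
  proof (rule antisym)
    show "blinfun_apply f x \<le> c" by (rule xle[OF f]) simp
    have "blinfun_apply (- f) x \<le> - c"
      by (rule xle[OF tendsto_minus[OF f]]) (simp add: blinfun.minus_left)
    then show "c \<le> blinfun_apply f x" by (simp add: blinfun.minus_left)
  qed
  have xM: "x \<in> M"
  proof (rule ccontr)
    assume "x \<notin> M"
    then obtain f :: "'a \<Rightarrow>\<^sub>L real" and e where e: "e > 0" "\<And>m. m \<in> M \<Longrightarrow> blinfun_apply f m + e \<le> blinfun_apply f x"
      using separate_closed_convex[OF M, of x] uM[of 0] by (metis emptyE)
    have "blinfun_apply f x \<le> blinfun_apply f x - e"
      by (rule x) (use e(2)[OF uM] in \<open>auto simp: algebra_simps\<close>)
    with e(1) show False by simp
  qed
  \<comment> \<open>Weak lower semicontinuity of the norm, through a functional norming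
    \<open>x\<close>.\<close>
  have xr: "norm x \<le> r"
  proof -
    obtain f :: "'a \<Rightarrow>\<^sub>L real" where f: "norm f \<le> 1" "norm x \<le> blinfun_apply f x"
      using Hahn_Banach_norm[of "{x}" "norm x"] by auto
    have "blinfun_apply f (u (s n)) \<le> norm (u (s n))" for n
      using norm_blinfun[of f "u (s n)"] mult_right_mono[OF f(1) norm_ge_zero[of "u (s n)"]]
      by simp
    from xle[OF r this] f(2) show ?thesis by simp
  qed
  have "(\<lambda>n. (norm (u (s n)))\<^sup>2 - 2 * blinfun_apply j (u (s n))) \<longlonglongrightarrow> r\<^sup>2 - 2 * a"
    by (intro tendsto_intros r a)
  from LIMSEQ_unique[OF this] LIMSEQ_subseq_LIMSEQ[OF lim s] have "d = r\<^sup>2 - 2 * a"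
    by (simp add: o_def)
  \<comment> \<open>Since \<open>j\<close> takes the limit value \<open>a\<close> at
    \<open>x\<close>, the lower bound \<open>d\<close> at \<open>x\<close> compares the squared
    norms alone: no norm is lost in the limit, and \<open>x\<close> attains
    \<open>d\<close>.\<close>
  with d[OF xM] xeq[OF a] have "r\<^sup>2 \<le> (norm x)\<^sup>2" by simp
  then have "r \<le> norm x" by (rule power2_le_imp_le) simp
  with xr have "r = norm x" by simp
  with s xM \<open>d = _\<close> r b xeq[OF a] xeq[OF b] show ?thesis by (intro that[of s x]) auto
qed

text \<open>At the midpoint \<open>m\<close> the linear term averages, so the squared norm of
  \<open>m\<close> is at least the average of the squared norms of \<open>x\<close> and
  \<open>y\<close>. Convexity of the square then forces equal norms, and rescaling to the unit
  sphere contradicts strict convexity.\<close>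

lemma minimizer_unique:
  fixes x y :: "'a::real_normed_vector" and j :: "'a \<Rightarrow>\<^sub>L real"
  assumes sc: "strictly_convex_space TYPE('a)" and M: "convex M" "x \<in> M" "y \<in> M"
    and d: "\<And>m. m \<in> M \<Longrightarrow> d \<le> (norm m)\<^sup>2 - 2 * blinfun_apply j m"
    and x: "(norm x)\<^sup>2 - 2 * blinfun_apply j x = d"
    and y: "(norm y)\<^sup>2 - 2 * blinfun_apply j y = d"
  shows "x = y"
proof (rule ccontr)
  assume "x \<noteq> y"
  define m where "m = (1/2) *\<^sub>R (x + y)"
  have "m \<in> M" unfolding m_def
    using convexD[OF M, of "1/2" "1/2"] by (simp add: scaleR_add_right)
  moreover have "blinfun_apply j m = (blinfun_apply j x + blinfun_apply j y) / 2"
    by (simp add: m_def blinfun.scaleR_right blinfun.add_right)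
  ultimately have "((norm x)\<^sup>2 + (norm y)\<^sup>2) / 2 \<le> (norm m)\<^sup>2"
    using d[of m] x y by argo
  moreover have tri: "norm m \<le> (norm x + norm y) / 2"
    using norm_triangle_ineq[of x y] by (simp add: m_def)
  moreover have "(norm m)\<^sup>2 \<le> ((norm x + norm y) / 2)\<^sup>2"
    using tri by (intro power_mono) auto
  moreover have "((norm x)\<^sup>2 + (norm y)\<^sup>2) / 2 - ((norm x + norm y) / 2)\<^sup>2 = ((norm x - norm y) / 2)\<^sup>2"
    by (simp add: power2_eq_square field_simps)
  ultimately have "((norm x - norm y) / 2)\<^sup>2 \<le> 0" and le: "((norm x)\<^sup>2 + (norm y)\<^sup>2) / 2 \<le> (norm m)\<^sup>2"
    by linarith+
  then have eq: "norm x = norm y" by simp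
  have "(norm x)\<^sup>2 \<le> (norm m)\<^sup>2" using le unfolding eq by argo
  then have "norm x \<le> norm m" by (rule power2_le_imp_le) simp
  define r where "r = norm x"
  have "r > 0" using eq \<open>x \<noteq> y\<close> by (auto simp: r_def)
  let ?x = "(1/r) *\<^sub>R x" and ?y = "(1/r) *\<^sub>R y"
  have "norm ?x = 1" "norm ?y = 1" "?x \<noteq> ?y"
    using eq \<open>r > 0\<close> \<open>x \<noteq> y\<close> by (auto simp: r_def)
  then have "norm ((1/2) *\<^sub>R (?x + ?y)) < 1"
    using sc unfolding strictly_convex_space_def by blast
  also have "(1/2) *\<^sub>R (?x + ?y) = (1/r) *\<^sub>R m"
    by (simp add: m_def scaleR_add_right mult.commute)
  finally have "norm m < r" using \<open>r > 0\<close> by (simp add: field_simps)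
  with \<open>norm x \<le> norm m\<close> show False by (simp add: r_def)
qed

text \<open>Property (KK) speaks of the unit sphere only, so the sequence and its limit are
  normalized. This is impossible for \<open>x = 0\<close>, where norm convergence is already strong
  convergence.\<close>

lemma KK_convergence:
  fixes u :: "nat \<Rightarrow> 'a::real_normed_vector"
  assumes KK: "KK_space TYPE('a)" and w: "weakly_converges u x"
    and n: "(\<lambda>n. norm (u n)) \<longlonglongrightarrow> norm x"
  shows "u \<longlonglongrightarrow> x"
proof (cases "x = 0")
  case True
  then show ?thesis using n by (simp add: tendsto_norm_zero_iff)
next
  case False
  then have "eventually (\<lambda>n. norm (u n) > 0) sequentially"
    using order_tendstoD(1)[OF n, of 0] zero_less_norm_iff by blast
  then obtain N where N: "\<And>n. n \<ge> N \<Longrightarrow> u n \<noteq> 0" by (auto simp: eventually_sequentially)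
  \<comment> \<open>The shift by \<open>N\<close> puts every term on the sphere, as
    \<open>KK_space\<close> demands, and not just almost every term.\<close>
  define v where "v n = (1 / norm (u (n + N))) *\<^sub>R u (n + N)" for n
  have nN: "(\<lambda>n. norm (u (n + N))) \<longlonglongrightarrow> norm x" using n by (rule LIMSEQ_ignore_initial_segment)
  have "weakly_converges v ((1 / norm x) *\<^sub>R x)"
    unfolding weakly_converges_def
  proof
    fix f :: "'a \<Rightarrow>\<^sub>L real"
    have f: "(\<lambda>n. blinfun_apply f (u (n + N))) \<longlonglongrightarrow> blinfun_apply f x"
      using w unfolding weakly_converges_def by (intro LIMSEQ_ignore_initial_segment) simp
    show "(\<lambda>n. blinfun_apply f (v n)) \<longlonglongrightarrow> blinfun_apply f ((1 / norm x) *\<^sub>R x)"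
      unfolding v_def blinfun.scaleR_right
      by (rule tendsto_scaleR[OF tendsto_divide[OF tendsto_const nN] f]) (use False in simp)
  qed
  moreover have "\<forall>n. v n \<in> sphere 0 1" "(1 / norm x) *\<^sub>R x \<in> sphere 0 1"
    using N False by (auto simp: v_def)
  ultimately have "v \<longlonglongrightarrow> (1 / norm x) *\<^sub>R x" using KK unfolding KK_space_def by blast
  from tendsto_scaleR[OF nN this] have "(\<lambda>n. u (n + N)) \<longlonglongrightarrow> x"
    using N False by (simp add: v_def)
  then show ?thesis by (rule LIMSEQ_offset)
qed

lemma minimizing_sequence_converges:
  fixes u :: "nat \<Rightarrow> 'a::real_normed_vector" and j :: "'a \<Rightarrow>\<^sub>L real"
  assumes refl: "reflexive_space TYPE('a)" and sc: "strictly_convex_space TYPE('a)"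
    and KK: "KK_space TYPE('a)" and M: "closed M" "convex M"
    and d: "\<And>m. m \<in> M \<Longrightarrow> d \<le> (norm m)\<^sup>2 - 2 * blinfun_apply j m"
    and x: "x \<in> M" "(norm x)\<^sup>2 - 2 * blinfun_apply j x = d"
    and uM: "\<And>n. u n \<in> M" and bdd: "bounded (range u)"
    and lim: "(\<lambda>n. (norm (u n))\<^sup>2 - 2 * blinfun_apply j (u n)) \<longlonglongrightarrow> d"
  shows "u \<longlonglongrightarrow> x"
proof -
  have sub: "\<exists>s. strict_mono s \<and> (\<lambda>n. blinfun_apply h (u (r (s n)))) \<longlonglongrightarrow> blinfun_apply h x
      \<and> (\<lambda>n. norm (u (r (s n)))) \<longlonglongrightarrow> norm x"
    if r: "strict_mono r" for h :: "'a \<Rightarrow>\<^sub>L real" and r :: "nat \<Rightarrow> nat"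
  proof -
    have b: "bounded (range (\<lambda>n. u (r n)))" using bdd by (rule bounded_subset) auto
    have l: "(\<lambda>n. (norm (u (r n)))\<^sup>2 - 2 * blinfun_apply j (u (r n))) \<longlonglongrightarrow> d"
      using LIMSEQ_subseq_LIMSEQ[OF lim r] by (simp add: o_def)
    obtain s y where s: "strict_mono s" and y: "y \<in> M" "(norm y)\<^sup>2 - 2 * blinfun_apply j y = d"
      and lims: "(\<lambda>n. blinfun_apply h (u (r (s n)))) \<longlonglongrightarrow> blinfun_apply h y"
      "(\<lambda>n. norm (u (r (s n)))) \<longlonglongrightarrow> norm y"
      by (rule minimizing_subsequence[where u = "\<lambda>n. u (r n)" and j = j and d = d and h = h,
            OF refl M _ b l d]) (simp_all add: uM)
    \<comment> \<open>The cluster point \<open>y\<close> depends on \<open>r\<close> and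
      \<open>h\<close>, but as a minimizer it must be \<open>x\<close>; hence all subsequences and
      all test functionals share one limit.\<close>
    have "y = x" by (rule minimizer_unique[OF sc M(2) y(1) x(1) d y(2) x(2)])
    with s lims show ?thesis by auto
  qed
  have "weakly_converges u x"
    unfolding weakly_converges_def
  proof
    fix h :: "'a \<Rightarrow>\<^sub>L real"
    show "(\<lambda>n. blinfun_apply h (u n)) \<longlonglongrightarrow> blinfun_apply h x"
      by (rule LIMSEQ_of_subsequences) (use sub[of _ h] in blast)
  qed
  moreover have "(\<lambda>n. norm (u n)) \<longlonglongrightarrow> norm x"
    by (rule LIMSEQ_of_subsequences) (use sub[of _ 0] in blast)
  ultimately show ?thesis by (rule KK_convergence[OF KK])
qed

subsection \<open>The duality mapping\<close>

text \<open>Smulian's criterion: the derivative of the norm is the strong limit of all almost norming functionals.\<close>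

lemma norm_derivative_strongly_exposed:
  fixes x :: "'a::real_normed_vector"
  assumes "norm differentiable (at x)"
  obtains D :: "'a \<Rightarrow>\<^sub>L real" where
    "\<And>e. e > 0 \<Longrightarrow> \<exists>\<eta>>0. \<forall>g. norm g \<le> 1 \<longrightarrow> norm x - \<eta> \<le> blinfun_apply g x \<longrightarrow> norm (g - D) \<le> e"
proof -
  obtain D' where D': "(norm has_derivative D') (at x)"
    using assms by (auto simp: differentiable_def)
  then obtain D where D: "D' = blinfun_apply D"
    by (metis bounded_linear_Blinfun_apply has_derivative_bounded_linear)
  show ?thesis
  proof (rule that[of D])
    fix e :: real assume e: "e > 0"
    then obtain d where d: "d > 0" and
      le: "\<And>y. norm (y - x) < d \<Longrightarrow> norm (norm y - norm x - D (y - x)) \<le> e / 2 * norm (y - x)"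
      using D' unfolding has_derivative_at_alt D by (meson half_gt_zero)
    show "\<exists>\<eta>>0. \<forall>g. norm g \<le> 1 \<longrightarrow> norm x - \<eta> \<le> blinfun_apply g x \<longrightarrow> norm (g - D) \<le> e"
    \<comment> \<open>For a test vector \<open>h\<close> of norm \<open>d / 2\<close>, both the
      defect \<open>e * d / 4\<close> and the differentiation error equal
      \<open>e / 2 * norm h\<close>, together \<open>e * norm h\<close>. Homogeneity extends the
      estimate to all vectors.\<close>
    proof (intro exI[of _ "e * d / 4"] conjI allI impI)
      show "e * d / 4 > 0" using e d by simp
      fix g :: "'a \<Rightarrow>\<^sub>L real" assume g: "norm g \<le> 1" "norm x - e * d / 4 \<le> blinfun_apply g x"
      have small: "blinfun_apply (g - D) h \<le> e * norm h" if h: "norm h = d / 2" for h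
      proof -
        have "blinfun_apply g (x + h) \<le> norm (x + h)"
          using norm_blinfun[of g "x + h"] mult_right_mono[OF g(1) norm_ge_zero[of "x + h"]] by simp
        moreover have "norm ((x + h) - x) < d" using h d by simp
        from le[OF this] have "norm (x + h) - norm x - blinfun_apply D h \<le> e / 2 * norm h"
          unfolding real_norm_def add_diff_cancel_left' by (rule abs_le_D1)
        ultimately have "blinfun_apply g h - blinfun_apply D h \<le> e * d / 4 + e / 2 * norm h"
          using g(2) by (simp add: blinfun.add_right)
        then show ?thesis unfolding h by (simp add: blinfun.diff_left algebra_simps)
      qed
      have all: "blinfun_apply (g - D) h \<le> e * norm h" for h
      proof (cases "h = 0")
        case False
        define k where "k = (d / 2 / norm h) *\<^sub>R h"
        have "norm k = d / 2" using False d by (simp add: k_def)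
        from small[OF this] have "(d / 2 / norm h) * blinfun_apply (g - D) h \<le> (d / 2 / norm h) * (e * norm h)"
          using False d by (simp add: k_def blinfun.scaleR_right mult.commute)
        then show ?thesis using False d by (subst (asm) mult_le_cancel_left_pos) auto
      qed simp
      show "norm (g - D) \<le> e"
      proof (rule norm_blinfun_bound)
        fix h show "norm (blinfun_apply (g - D) h) \<le> e * norm h"
          using all[of h] all[of "- h"] by (simp add: blinfun.minus_right)
      qed (use e in simp)
    qed
  qed
qed

text \<open>Makes the definite description in \<open>duality_map\<close> meaningful. Existence comes
  from a norming functional scaled by \<open>norm u\<close>. For uniqueness, any candidate divided
  by \<open>norm u\<close> norms \<open>u\<close> exactly, hence equals the derivative
  \<open>D\<close> of the norm at \<open>u\<close>.\<close>

lemma duality_map_ex1: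
  assumes fs: "frechet_smooth_space TYPE('a::real_normed_vector)"
  shows "\<exists>!j. blinfun_apply j u = (norm (u::'a))\<^sup>2 \<and> (norm u)\<^sup>2 = (norm j)\<^sup>2"
proof (cases "u = 0")
  case True
  then show ?thesis by auto
next
  case False
  then have nu: "norm u > 0" by simp
  obtain f :: "'a \<Rightarrow>\<^sub>L real" where f: "norm f \<le> 1" "norm u \<le> blinfun_apply f u"
    using Hahn_Banach_norm[of "{u}" "norm u"] by auto
  have "norm u \<le> norm f * norm u" and "blinfun_apply f u \<le> norm f * norm u"
    using norm_blinfun[of f u] f(2) by auto
  with nu f have "norm f = 1" "blinfun_apply f u = norm u" by auto
  then have ex: "blinfun_apply (norm u *\<^sub>R f) u = (norm u)\<^sup>2 \<and> (norm u)\<^sup>2 = (norm (norm u *\<^sub>R f))\<^sup>2"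
    by (simp add: blinfun.scaleR_left power2_eq_square)
  have "norm differentiable (at u)" using fs False unfolding frechet_smooth_space_def by blast
  then obtain D :: "'a \<Rightarrow>\<^sub>L real" where
    D: "\<And>e. e > 0 \<Longrightarrow> \<exists>\<eta>>0. \<forall>g. norm g \<le> 1 \<longrightarrow> norm u - \<eta> \<le> blinfun_apply g u \<longrightarrow> norm (g - D) \<le> e"
    using norm_derivative_strongly_exposed by blast
  have "j = norm u *\<^sub>R D" if j: "blinfun_apply j u = (norm u)\<^sup>2 \<and> (norm u)\<^sup>2 = (norm j)\<^sup>2" for j
  proof -
    have "norm j = norm u" using j by simp
    then have g: "norm ((1 / norm u) *\<^sub>R j) \<le> 1" "norm u \<le> blinfun_apply ((1 / norm u) *\<^sub>R j) u"
      using nu j by (simp_all add: blinfun.scaleR_left power2_eq_square)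
    have "norm ((1 / norm u) *\<^sub>R j - D) \<le> 0"
    proof (rule field_le_epsilon)
      fix e :: real assume "e > 0"
      with D[of e] g show "norm ((1 / norm u) *\<^sub>R j - D) \<le> 0 + e"
        by (smt (verit, best))
    qed
    then have "D = (1 / norm u) *\<^sub>R j" by simp
    then show ?thesis using nu by simp
  qed
  with ex show ?thesis by blast
qed

lemma
  fixes u :: "'a::real_normed_vector"
  assumes fs: "frechet_smooth_space TYPE('a)"
  shows duality_map_apply_self: "blinfun_apply (duality_map u) u = (norm u)\<^sup>2"
    and norm_duality_map: "norm (duality_map u) = norm u"
proof -
  note * = theI'[OF duality_map_ex1[OF fs, of u], folded duality_map_def]
  from * show "blinfun_apply (duality_map u) u = (norm u)\<^sup>2" by blast
  from * show "norm (duality_map u) = norm u" by (metis norm_ge_zero power2_eq_imp_eq)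
qed

lemma duality_map_continuous:
  fixes t :: "nat \<Rightarrow> 'a::real_normed_vector"
  assumes fs: "frechet_smooth_space TYPE('a)" and t: "t \<longlonglongrightarrow> l"
  shows "(\<lambda>n. duality_map (t n)) \<longlonglongrightarrow> duality_map l"
proof (cases "l = 0")
  case True
  have "(\<lambda>n. norm (duality_map (t n))) \<longlonglongrightarrow> norm (duality_map l)"
    using tendsto_norm[OF t] by (simp add: norm_duality_map[OF fs])
  moreover have "duality_map l = 0" using norm_duality_map[OF fs, of l] True by simp
  ultimately show ?thesis by (simp add: tendsto_norm_zero_iff)
next
  case False
  then have "norm differentiable (at l)" using fs unfolding frechet_smooth_space_def by blast
  then obtain D :: "'a \<Rightarrow>\<^sub>L real" where
    D: "\<And>e. e > 0 \<Longrightarrow> \<exists>\<eta>>0. \<forall>g. norm g \<le> 1 \<longrightarrow> norm l - \<eta> \<le> blinfun_apply g l \<longrightarrow> norm (g - D) \<le> e"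
    using norm_derivative_strongly_exposed by blast
  have *: "(\<lambda>n. duality_map (s n)) \<longlonglongrightarrow> norm l *\<^sub>R D" if s: "s \<longlonglongrightarrow> l" for s
  proof -
    \<comment> \<open>If \<open>s n = 0\<close>, division by zero gives \<open>g n = 0\<close>,
      which is consistent with all facts stated about \<open>g\<close> below.\<close>
    define g where "g n = (1 / norm (s n)) *\<^sub>R duality_map (s n)" for n
    have g1: "norm (g n) \<le> 1" for n by (simp add: g_def norm_duality_map[OF fs])
    \<comment> \<open>One distance is lost in moving the argument of \<open>g n\<close> from
      \<open>s n\<close> to \<open>l\<close>, the other in comparing the norms of \<open>s n\<close>
      and \<open>l\<close>.\<close>
    have gl: "norm l - 2 * norm (s n - l) \<le> blinfun_apply (g n) l" for n
    proof -
      have "blinfun_apply (g n) (s n) = norm (s n)"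
        by (simp add: g_def blinfun.scaleR_left duality_map_apply_self[OF fs] power2_eq_square)
      moreover have "blinfun_apply (g n) (s n - l) \<le> norm (s n - l)"
        using norm_blinfun[of "g n" "s n - l"] mult_right_mono[OF g1[of n] norm_ge_zero[of "s n - l"]]
        by simp
      moreover have "norm l - norm (s n) \<le> norm (s n - l)"
        using norm_triangle_ineq2[of l "s n"] by (simp add: norm_minus_commute)
      ultimately show ?thesis by (simp add: blinfun.diff_right)
    qed
    have "g \<longlonglongrightarrow> D"
    proof (rule tendstoI)
      fix e :: real assume "e > 0"
      with D[of "e / 2"] obtain \<eta> where "\<eta> > 0" and
        \<eta>: "\<And>g. norm g \<le> 1 \<Longrightarrow> norm l - \<eta> \<le> blinfun_apply g l \<Longrightarrow> norm (g - D) \<le> e / 2"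
        by auto
      have "eventually (\<lambda>n. dist (s n) l < \<eta> / 2) sequentially"
        using s \<open>\<eta> > 0\<close> by (intro tendstoD) auto
      then show "eventually (\<lambda>n. dist (g n) D < e) sequentially"
      proof eventually_elim
        case (elim n)
        then have "norm l - \<eta> \<le> blinfun_apply (g n) l"
          using gl[of n] by (simp add: dist_norm)
        with \<eta>[OF g1] \<open>e > 0\<close> show ?case by (fastforce simp: dist_norm)
      qed
    qed
    from tendsto_scaleR[OF tendsto_norm[OF s] this]
    have "(\<lambda>n. norm (s n) *\<^sub>R g n) \<longlonglongrightarrow> norm l *\<^sub>R D" .
    moreover have "norm (s n) *\<^sub>R g n = duality_map (s n)" for n
      using norm_duality_map[OF fs, of "s n"] by (cases "s n = 0") (simp_all add: g_def)
    ultimately show ?thesis by simp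
  qed
  \<comment> \<open>The constant sequence \<open>l\<close> identifies the limit as
    \<open>duality_map l\<close>.\<close>
  from *[OF t] LIMSEQ_unique[OF *[of "\<lambda>_. l"] tendsto_const] show ?thesis by simp
qed

subsection \<open>Property (phi-UC)\<close>

lemma phi_lower_bound:
  fixes u v :: "'a::real_normed_vector"
  assumes "frechet_smooth_space TYPE('a)"
  shows "(norm u - norm v)\<^sup>2 \<le> phi u v"
proof -
  have "blinfun_apply (duality_map v) u \<le> norm v * norm u"
    using norm_blinfun[of "duality_map v" u] norm_duality_map[OF assms, of v] by simp
  then show ?thesis by (simp add: phi_def power2_diff mult.commute)
qed

lemma dist_phi_le:
  fixes M N :: "'a::real_normed_vector set"
  assumes "frechet_smooth_space TYPE('a)" "u \<in> M" "v \<in> N"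
  shows "dist_phi M N \<le> phi u v"
  unfolding dist_phi_def
proof (rule cInf_lower)
  show "bdd_below {phi u v |u v. u \<in> M \<and> v \<in> N}"
    using phi_lower_bound[OF assms(1)] by (intro bdd_belowI[of _ 0]) (auto intro: order_trans[OF zero_le_power2])
qed (use assms in blast)

lemma phi_tendsto_zero:
  fixes u v :: "nat \<Rightarrow> 'a::real_normed_vector"
  assumes fs: "frechet_smooth_space TYPE('a)" and u: "u \<longlonglongrightarrow> x" and v: "v \<longlonglongrightarrow> x"
  shows "(\<lambda>n. phi (u n) (v n)) \<longlonglongrightarrow> 0"
proof -
  have "(\<lambda>n. phi (u n) (v n)) \<longlonglongrightarrow> (norm x)\<^sup>2 - 2 * blinfun_apply (duality_map x) x + (norm x)\<^sup>2"
    unfolding phi_def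
    by (intro tendsto_intros u v duality_map_continuous[OF fs])
  then show ?thesis by (simp add: duality_map_apply_self[OF fs])
qed

lemma phi_bounded:
  fixes u t :: "nat \<Rightarrow> 'a::real_normed_vector"
  assumes fs: "frechet_smooth_space TYPE('a)" and t: "bounded (range t)"
    and lim: "(\<lambda>n. phi (u n) (t n)) \<longlonglongrightarrow> d"
  shows "bounded (range u)"
proof -
  obtain T where T: "\<And>n. norm (t n) \<le> T" using t by (auto simp: bounded_iff)
  obtain K where K: "\<And>n. \<bar>phi (u n) (t n)\<bar> \<le> K"
    using convergent_imp_Bseq[OF convergentI[OF lim]] unfolding Bseq_def real_norm_def by blast
  have "norm (u n) \<le> T + sqrt K" for n
  proof -
    have "(norm (u n) - norm (t n))\<^sup>2 \<le> K"
      using phi_lower_bound[OF fs, of "u n" "t n"] K[of n] by linarith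
    then have "norm (u n) - norm (t n) \<le> sqrt K" by (rule real_le_rsqrt)
    with T[of n] show ?thesis by simp
  qed
  then show ?thesis by (auto simp: bounded_iff)
qed

text \<open>Replacing \<open>t n\<close> by \<open>l\<close> changes the pairing by at most
  \<open>norm (duality_map (t n) - duality_map l)\<close> times a bound for \<open>u\<close>, which
  vanishes in the limit. Dropping the squared norm of the second argument leaves a functional of the
  form minimized above.\<close>

lemma phi_tendsto_change_right:
  fixes u t :: "nat \<Rightarrow> 'a::real_normed_vector"
  assumes fs: "frechet_smooth_space TYPE('a)" and t: "t \<longlonglongrightarrow> l"
    and lim: "(\<lambda>n. phi (u n) (t n)) \<longlonglongrightarrow> d" and bdd: "bounded (range u)"
  shows "(\<lambda>n. (norm (u n))\<^sup>2 - 2 * blinfun_apply (duality_map l) (u n)) \<longlonglongrightarrow> d - (norm l)\<^sup>2"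
proof -
  obtain K where K: "\<And>n. norm (u n) \<le> K" using bdd by (auto simp: bounded_iff)
  have "(\<lambda>n. norm (duality_map (t n) - duality_map l) * K) \<longlonglongrightarrow> norm (duality_map l - duality_map l) * K"
    by (intro tendsto_intros duality_map_continuous[OF fs t])
  then have "(\<lambda>n. norm (duality_map (t n) - duality_map l) * K) \<longlonglongrightarrow> 0" by simp
  moreover have "norm (blinfun_apply (duality_map (t n) - duality_map l) (u n))
      \<le> norm (duality_map (t n) - duality_map l) * K" for n
    using norm_blinfun mult_left_mono[OF K] by (meson norm_ge_zero order_trans)
  ultimately have "(\<lambda>n. blinfun_apply (duality_map (t n) - duality_map l) (u n)) \<longlonglongrightarrow> 0"
    by (rule Lim_null_comparison[OF always_eventually[OF allI], rotated])
  from tendsto_diff[OF tendsto_add[OF lim tendsto_mult_left[OF this, of 2]] tendsto_power[OF tendsto_norm[OF t], of 2]]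
  show ?thesis by (simp add: phi_def blinfun.diff_left algebra_simps)
qed

theorem theorem2p19:
  fixes M N :: "'a::banach set"
  assumes "reflexive_space TYPE('a)"
    and "strictly_convex_space TYPE('a)"
    and "frechet_smooth_space TYPE('a)"
    and "KK_space TYPE('a)"
    and "M \<noteq> {}" and "closed M" and "convex M"
    and "N \<noteq> {}" and "compact N"
  shows "phi_UC M N"
  unfolding phi_UC_def
proof (intro allI impI)
  note fs = \<open>frechet_smooth_space TYPE('a)\<close>
  fix u v t :: "nat \<Rightarrow> 'a"
  assume uM: "\<forall>n. u n \<in> M" and vM: "\<forall>n. v n \<in> M" and tN: "\<forall>n. t n \<in> N"
    and u: "(\<lambda>n. phi (u n) (t n)) \<longlonglongrightarrow> dist_phi M N"
    and v: "(\<lambda>n. phi (v n) (t n)) \<longlonglongrightarrow> dist_phi M N"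
  have "bounded (range t)"
    using compact_imp_bounded[OF \<open>compact N\<close>] tN by (auto intro: bounded_subset)
  then have bdd: "bounded (range u)" "bounded (range v)"
    using phi_bounded[OF fs] u v by blast+
  show "(\<lambda>n. phi (u n) (v n)) \<longlonglongrightarrow> 0"
  \<comment> \<open>The sequence \<open>t\<close> need not converge, and its cluster point
    \<open>l\<close> may vary with the subsequence; only the limit 0 is common to all.\<close>
  proof (rule LIMSEQ_of_subsequences)
    fix r :: "nat \<Rightarrow> nat" assume r: "strict_mono r"
    obtain l s where l: "l \<in> N" and s: "strict_mono (s :: nat \<Rightarrow> nat)" and tl: "(\<lambda>n. t (r (s n))) \<longlonglongrightarrow> l"
      using \<open>compact N\<close> tN unfolding compact_def
      by (metis (mono_tags, lifting) comp_apply tendsto_cong always_eventually)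
    define q where "q n = r (s n)" for n
    have q: "strict_mono q" using strict_mono_o[OF r s] by (simp add: q_def[abs_def] o_def)
    define j where "j = duality_map l"
    define d where "d = dist_phi M N - (norm l)\<^sup>2"
    have d: "d \<le> (norm m)\<^sup>2 - 2 * blinfun_apply j m" if "m \<in> M" for m
      using dist_phi_le[OF fs that l] by (simp add: d_def j_def phi_def)
    have min: "(\<lambda>n. (norm (w (q n)))\<^sup>2 - 2 * blinfun_apply j (w (q n))) \<longlonglongrightarrow> d" "bounded (range (\<lambda>n. w (q n)))"
      if w: "(\<lambda>n. phi (w n) (t n)) \<longlonglongrightarrow> dist_phi M N" and b: "bounded (range w)" for w
    proof -
      show b': "bounded (range (\<lambda>n. w (q n)))" using b by (rule bounded_subset) auto
      show "(\<lambda>n. (norm (w (q n)))\<^sup>2 - 2 * blinfun_apply j (w (q n))) \<longlonglongrightarrow> d"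
        unfolding d_def j_def
        using LIMSEQ_subseq_LIMSEQ[OF w q] tl
        by (intro phi_tendsto_change_right[OF fs _ _ b', of "\<lambda>n. t (q n)"]) (simp_all add: o_def q_def)
    qed
    \<comment> \<open>Only the existence of a minimizer is wanted here, so the test functional is
      0.\<close>
    obtain x where x: "x \<in> M" "(norm x)\<^sup>2 - 2 * blinfun_apply j x = d"
      by (rule minimizing_subsequence[where u = "\<lambda>n. u (q n)" and j = j and d = d and h = 0,
            OF assms(1) \<open>closed M\<close> \<open>convex M\<close> _ min(2,1)[OF u bdd(1)] d])
        (simp_all add: uM)
    \<comment> \<open>The minimizer \<open>x\<close> belongs to \<open>l\<close> alone, so
      \<open>u\<close> and \<open>v\<close> have the same limit along \<open>q\<close>.\<close>
    have conv: "(\<lambda>n. w (q n)) \<longlonglongrightarrow> x"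
      if "(\<lambda>n. phi (w n) (t n)) \<longlonglongrightarrow> dist_phi M N" "bounded (range w)" "\<And>n. w n \<in> M" for w
      by (rule minimizing_sequence_converges[where u = "\<lambda>n. w (q n)" and j = j and d = d,
            OF assms(1,2,4) \<open>closed M\<close> \<open>convex M\<close> d x that(3) min(2,1)[OF that(1,2)]])
    have "(\<lambda>n. phi (u (q n)) (v (q n))) \<longlonglongrightarrow> 0"
      using conv[OF u bdd(1)] conv[OF v bdd(2)] uM vM by (intro phi_tendsto_zero[OF fs, of _ x]) auto
    then show "\<exists>s. strict_mono s \<and> (\<lambda>n. phi (u (r (s n))) (v (r (s n)))) \<longlonglongrightarrow> 0"
      using s by (auto simp: q_def)
  qed
qed

end
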